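(* Let $u^n$ be the solution of the single step time stepping scheme given by the three-stage Lobatto IIIC method with step size $\Delta t$, applied to $u'(t)+Au(t)=f(t)$, $0<t<T$, $u(0)=u^0$, and let $U_k^n$ be the solution obtained from the parareal algorithm with the backward Euler method (step size $\Delta T=J\Delta t$) as coarse propagator and this three-stage Lobatto IIIC scheme as fine propagator (all defined in the context). Then for all integers $J\ge2$ there holds $$\max_{1\le n\le N_c}\|U_k^n-u^{nJ}\|\le c\,\gamma^k\quad\text{with}\quad\gamma=0.31,$$ where $c$ denotes a constant.
   Context: $H$ is a Hilbert space with norm $\|\cdot\|$; $A$ is a positive definite, selfadjoint, linear operator with compact inverse, defined in $H$ with domain $D(A)$ dense in $H$; $T>0$; $u^0\in H$ is a given initial condition and $f:[0,T]\to H$ a given forcing term, with $f\in C([0,T];H)$ in the definition of the propagators below. Functions of $A$ such as $r(-\Delta t A)$ are defined by the spectral decomposition of $A$; $I$ is the identity. Three-stage Lobatto IIIC method ($m=3$): Runge–Kutta matrix $M=\begin{pmatrix}\frac16&-\frac13&\frac16\\ \frac16&\frac5{12}&-\frac1{12}\\ \frac16&\frac23&\frac16\end{pmatrix}$, weights $b=(\frac16,\frac23,\frac16)^\top$, nodes $c_1=0$, $c_2=\frac12$, $c_3=1$. Its rational functions are $r(z)=1+z\,b^\top(I-zM)^{-1}\mathbf 1$ with $\mathbf 1=(1,1,1)^\top$, and $(p_1(z),\dots,p_m(z))=b^\top(I-zM)^{-1}$. In particular $r(-s)=\frac{24-6s}{s^3+6s^2+18s+24}$. Grids: $\Delta t=T/N$,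 $t_n=n\Delta t$; $\Delta T=J\Delta t$, $N_c=T/\Delta T$ is assumed to be an integer (so $N=JN_c$), $T_n=n\Delta T$. Single step scheme: starting from the given $u^0$, $$u^{n+1}=r(-\Delta t A)u^n+\Delta t\sum_{i=1}^m p_i(-\Delta t A)f(t_n+c_i\Delta t),\qquad 0\le n\le N-1.$$ Coarse propagator (backward Euler): $\mathcal G(T_n,\Delta T,v,f)=(I+\Delta T A)^{-1}(v+\Delta T f(T_n))$. Fine propagator: $\mathcal F(t,\Delta t,v,f)=r(-\Delta tA)v+\Delta t\sum_{i=1}^m p_i(-\Delta tA)f(t+c_i\Delta t)$. Parareal algorithm: initialize $U_0^0=u^0$, $U_0^{n+1}=\mathcal G(T_n,\Delta T,U_0^n,f)$ for $n=0,\dots,N_c-1$. For $k=0,1,2,\dots$ (until a stopping criterion is met): (Step 1) for each $n=0,\dots,N_c-1$ set $\widetilde U^{n,0}=U_k^n$, $\widetilde U^{n,j+1}=\mathcal F(T_n+j\Delta t,\Delta t,\widetilde U^{n,j},f)$ for $j=0,\dots,J-1$, and $\widetilde U^{n+1}=\widetilde U^{n,J}$; (Step 2) set $U_{k+1}^0=u^0$ and $$U_{k+1}^{n+1}=\mathcal G(T_n,\Delta T,U_{k+1}^n,f)+\widetilde U^{n+1}-\mathcal G(T_n,\Delta T,U_k^n,f),\qquad n=0,\dots,N_c-1.$$ *)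

theory Defs
  imports "HOL-Analysis.Analysis"
begin

(* An unbounded operator is a pair of a domain D and a map A whose values outside D are irrelevant. *)

definition linear_operator :: "'a::real_vector set \<Rightarrow> ('a \<Rightarrow> 'a) \<Rightarrow> bool" where
  "linear_operator D A \<longleftrightarrow> subspace D \<and>
     (\<forall>x\<in>D. \<forall>y\<in>D. A (x + y) = A x + A y) \<and> (\<forall>a. \<forall>x\<in>D. A (a *\<^sub>R x) = a *\<^sub>R A x)"

definition densely_defined :: "'a::topological_space set \<Rightarrow> bool" where
  "densely_defined D \<longleftrightarrow> closure D = UNIV"

definition adjoint_graph :: "'a::real_inner set \<Rightarrow> ('a \<Rightarrow> 'a) \<Rightarrow> ('a \<times> 'a) set" where
  "adjoint_graph D A = {(y, z). \<forall>x\<in>D. A x \<bullet> y = x \<bullet> z}"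

(* Equality of graphs includes equality of the domains of A and of its adjoint. *)
definition selfadjoint :: "'a::real_inner set \<Rightarrow> ('a \<Rightarrow> 'a) \<Rightarrow> bool" where
  "selfadjoint D A \<longleftrightarrow> adjoint_graph D A = {(x, A x) | x. x \<in> D}"

definition positive_definite :: "'a::real_inner set \<Rightarrow> ('a \<Rightarrow> 'a) \<Rightarrow> bool" where
  "positive_definite D A \<longleftrightarrow> (\<forall>x\<in>D. x \<noteq> 0 \<longrightarrow> A x \<bullet> x > 0)"

definition compact_operator :: "('a::real_normed_vector \<Rightarrow> 'a) \<Rightarrow> bool" where
  "compact_operator K \<longleftrightarrow> linear K \<and> (\<forall>S. bounded S \<longrightarrow> compact (closure (K ` S)))"

definition has_compact_inverse :: "'a::real_normed_vector set \<Rightarrow> ('a \<Rightarrow> 'a) \<Rightarrow> bool" where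
  "has_compact_inverse D A \<longleftrightarrow> bij_betw A D UNIV \<and> compact_operator (the_inv_into D A)"

definition eigenspace :: "'a::real_vector set \<Rightarrow> ('a \<Rightarrow> 'a) \<Rightarrow> real \<Rightarrow> 'a set" where
  "eigenspace D A l = {x \<in> D. A x = l *\<^sub>R x}"

definition eigenvalues :: "'a::real_vector set \<Rightarrow> ('a \<Rightarrow> 'a) \<Rightarrow> real set" where
  "eigenvalues D A = {l. eigenspace D A l \<noteq> {0}}"

(* Meaningful for closed subspaces V of a complete space. *)
definition orthogonal_projection :: "'a::real_inner set \<Rightarrow> 'a \<Rightarrow> 'a" where
  "orthogonal_projection V x = (THE y. y \<in> V \<and> (\<forall>z\<in>V. (x - y) \<bullet> z = 0))"

(* The function g(A), for g bounded on the eigenvalues: the spectrum of an operator with compact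
   inverse is pure point, so its spectral decomposition is the sum over the eigenvalues l of l times
   the orthogonal projection onto the eigenspace of l. *)
definition spectral_fun ::
    "'a::real_inner set \<Rightarrow> ('a \<Rightarrow> 'a) \<Rightarrow> (real \<Rightarrow> real) \<Rightarrow> 'a \<Rightarrow> 'a" where
  "spectral_fun D A g v =
     (\<Sum>\<^sub>\<infinity>l\<in>eigenvalues D A. g l *\<^sub>R orthogonal_projection (eigenspace D A l) v)"

definition lobatto_M :: "real ^ 3 ^ 3" where
  "lobatto_M = vector [vector [1/6, - 1/3, 1/6],
                       vector [1/6, 5/12, - 1/12],
                       vector [1/6, 2/3, 1/6]]"

definition lobatto_b :: "real ^ 3" where
  "lobatto_b = vector [1/6, 2/3, 1/6]"

definition lobatto_c :: "real ^ 3" where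
  "lobatto_c = vector [0, 1/2, 1]"

definition lobatto_r :: "real \<Rightarrow> real" where
  "lobatto_r z = 1 + z * (lobatto_b \<bullet> (matrix_inv (mat 1 - z *\<^sub>R lobatto_M) *v 1))"

definition lobatto_p :: "real \<Rightarrow> real ^ 3" where
  "lobatto_p z = lobatto_b v* matrix_inv (mat 1 - z *\<^sub>R lobatto_M)"

definition fine_prop ::
    "'a::real_inner set \<Rightarrow> ('a \<Rightarrow> 'a) \<Rightarrow> real \<Rightarrow> real \<Rightarrow> 'a \<Rightarrow> (real \<Rightarrow> 'a) \<Rightarrow> 'a" where
  "fine_prop D A t dt v f =
     spectral_fun D A (\<lambda>l. lobatto_r (- dt * l)) v
     + dt *\<^sub>R (\<Sum>i\<in>UNIV. spectral_fun D A (\<lambda>l. lobatto_p (- dt * l) $ i) (f (t + lobatto_c $ i * dt)))"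

definition coarse_prop ::
    "'a::real_inner set \<Rightarrow> ('a \<Rightarrow> 'a) \<Rightarrow> real \<Rightarrow> real \<Rightarrow> 'a \<Rightarrow> (real \<Rightarrow> 'a) \<Rightarrow> 'a" where
  "coarse_prop D A t dT v f = the_inv_into D (\<lambda>w. w + dT *\<^sub>R A w) (v + dT *\<^sub>R f t)"

(* j fine steps of size dt, starting from the value v at time t *)
primrec fine_steps ::
    "'a::real_inner set \<Rightarrow> ('a \<Rightarrow> 'a) \<Rightarrow> (real \<Rightarrow> 'a) \<Rightarrow> real \<Rightarrow> real \<Rightarrow> 'a \<Rightarrow> nat \<Rightarrow> 'a" where
  "fine_steps D A f dt t v 0 = v"
| "fine_steps D A f dt t v (Suc j) =
     fine_prop D A (t + real j * dt) dt (fine_steps D A f dt t v j) f"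

definition single_step ::
    "'a::real_inner set \<Rightarrow> ('a \<Rightarrow> 'a) \<Rightarrow> (real \<Rightarrow> 'a) \<Rightarrow> 'a \<Rightarrow> real \<Rightarrow> nat \<Rightarrow> 'a" where
  "single_step D A f u0 dt n = fine_steps D A f dt 0 u0 n"

fun parareal ::
    "'a::real_inner set \<Rightarrow> ('a \<Rightarrow> 'a) \<Rightarrow> (real \<Rightarrow> 'a) \<Rightarrow> 'a \<Rightarrow> real \<Rightarrow> nat \<Rightarrow> nat \<Rightarrow> nat \<Rightarrow> 'a" where
  "parareal D A f u0 dt J 0 0 = u0"
| "parareal D A f u0 dt J 0 (Suc n) =
     (let dT = real J * dt in
      coarse_prop D A (real n * dT) dT (parareal D A f u0 dt J 0 n) f)"
| "parareal D A f u0 dt J (Suc k) 0 = u0"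
| "parareal D A f u0 dt J (Suc k) (Suc n) =
     (let dT = real J * dt in
      coarse_prop D A (real n * dT) dT (parareal D A f u0 dt J (Suc k) n) f
      + fine_steps D A f dt (real n * dT) (parareal D A f u0 dt J k n) J
      - coarse_prop D A (real n * dT) dT (parareal D A f u0 dt J k n) f)"

end

theory Submission
  imports Defs
begin

text \<open>
  Write \<open>\<Delta>t\<close> and \<open>\<Delta>T = J \<Delta>t\<close> for the two step sizes, \<open>R = (I + \<Delta>T A)\<^sup>-\<^sup>1\<close> for the backward Euler
  resolvent, \<open>r\<close> for the stability function of the Lobatto scheme, and \<open>E(k, n)\<close> for the difference
  between the \<open>k\<close>-th parareal iterate and the fine solution at the coarse node \<open>n\<close>. Both propagators
  are affine in the initial value, so the forcing cancels and the error obeys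
  \<open>E(k+1, n+1) = R E(k+1, n) + (r(-\<Delta>t A)\<^sup>J - R) E(k, n)\<close> with \<open>E(k+1, 0) = 0\<close>.
  On the eigenspace of an eigenvalue \<open>l\<close> of \<open>A\<close> this is a scalar recursion with \<open>\<rho> = 1 / (1 + J s)\<close> in
  place of \<open>R\<close> and \<open>\<phi> = r(-s)\<^sup>J\<close>, where \<open>s = \<Delta>t l > 0\<close>. Summing the geometric series in \<open>\<rho>\<close>, the
  maximum over \<open>n\<close> of the component contracts in each iteration by \<open>\<bar>\<phi> - \<rho>\<bar> / (1 - \<rho>)\<close>
  (\<open>parareal_error_decay\<close>).

  That this quotient is at most \<open>0.31\<close> for all \<open>s > 0\<close> and \<open>J \<ge> 2\<close> is \<open>parareal_contraction_factor\<close>.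
  With \<open>x = J s\<close> the claim is \<open>1 - 0.31 x \<le> (1 + x) \<phi> \<le> 1 + 0.31 x\<close>. The upper half follows from
  \<open>\<bar>r(-s)\<bar> \<le> 1 / (1 + s)\<close> and Bernoulli's inequality. For the lower half, \<open>ln (r(-s))\<close> is concave and
  vanishes at \<open>0\<close>, so that \<open>r(-x/J)\<^sup>J \<ge> r(-x/2)\<^sup>2\<close>: the worst case is \<open>J = 2\<close>, which is a polynomial
  inequality.

  Contraction of every component suffices only if the initial components are controlled before the
  norm is taken, because the node \<open>n\<close> at which a component is largest depends on \<open>l\<close>. The components of
  \<open>E(0, n)\<close> are therefore bounded, for all \<open>n\<close> at once, by a weighted sum of the norms of the
  components of the initial value and of the sampled forcing terms. By Minkowski's inequality the
  \<open>\<ell>\<^sup>2\<close> norm over the spectrum of this majorant is at most \<open>2 \<parallel>u0\<parallel> + 4 T sup \<parallel>f\<parallel>\<close>, whatever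
  \<open>J\<close> and \<open>N\<close> are.

  The passage to components rests on the spectral theorem for \<open>A\<^sup>-\<^sup>1\<close>, a compact symmetric positive operator:
  every vector is the sum of its projections onto the eigenspaces of \<open>A\<close> (\<open>spectral_expansion\<close>). This also
  shows that backward Euler is multiplication by \<open>1 / (1 + \<Delta>T l)\<close> on each eigenspace.
\<close>

section \<open>The stability function of the three-stage Lobatto IIIC method\<close>

text \<open>
  The common denominator of \<open>r(-s)\<close> and the \<open>p\<^sub>i(-s)\<close>, equal to \<open>24 det (I + s M)\<close>.
\<close>
definition lobatto_denom :: "real \<Rightarrow> real" where
  "lobatto_denom s = 24 + 18 * s + 6 * s^2 + s^3"

lemma lobatto_denom_pos: "0 \<le> s \<Longrightarrow> 0 < lobatto_denom s"
  unfolding lobatto_denom_def by (intro add_pos_nonneg) auto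

text \<open>
  The row vector \<open>p(-s)\<close> is the only solution of the linear system \<open>p (I + s M) = b\<close>, so it suffices
  to check that the given vector solves it.
\<close>
lemma lobatto_p_formula:
  assumes "0 \<le> s"
  shows "lobatto_p (- s) =
    vector [(4 - s) / lobatto_denom s, (16 + 4 * s) / lobatto_denom s, (4 + 3 * s + s^2) / lobatto_denom s]"
    (is "_ = ?p")
proof -
  let ?B = "mat 1 - (- s) *\<^sub>R lobatto_M"
  note pos = lobatto_denom_pos[OF assms]
  have "det ?B = lobatto_denom s / 24"
    by (simp add: det_3 lobatto_M_def mat_def lobatto_denom_def field_simps power2_eq_square power3_eq_cube)
  then have inv: "invertible ?B"
    using pos by (simp add: invertible_det_nz)
  have "?p v* ?B = lobatto_b"
    using pos
    by (simp add: vec_eq_iff forall_3 vector_matrix_mult_def sum_3 mat_def lobatto_M_def lobatto_b_def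
          divide_simps) (simp add: lobatto_denom_def algebra_simps power2_eq_square power3_eq_cube)
  then have "lobatto_b v* matrix_inv ?B = ?p v* (?B ** matrix_inv ?B)"
    by (metis vector_matrix_mul_assoc)
  also have "?B ** matrix_inv ?B = mat 1"
    using someI_ex[OF inv[unfolded invertible_def]] by (simp add: matrix_inv_def)
  finally show ?thesis
    by (simp add: lobatto_p_def)
qed

lemma lobatto_p_bound:
  assumes "0 \<le> s"
  shows "\<bar>lobatto_p (- s) $ i\<bar> \<le> 1"
proof -
  have "0 \<le> s^2" "0 \<le> s^3"
    using assms by auto
  then have "\<bar>4 - s\<bar> \<le> lobatto_denom s" "\<bar>16 + 4 * s\<bar> \<le> lobatto_denom s"
      "\<bar>4 + 3 * s + s^2\<bar> \<le> lobatto_denom s"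
    using assms unfolding lobatto_denom_def abs_le_iff by auto
  moreover have "i = 1 \<or> i = 2 \<or> i = 3"
    using exhaust_3 by auto
  ultimately show ?thesis
    using lobatto_denom_pos[OF assms] by (auto simp: lobatto_p_formula[OF assms])
qed

text \<open>
  The definition gives \<open>r(z) = 1 + z (p\<^sub>1(z) + p\<^sub>2(z) + p\<^sub>3(z))\<close>.
\<close>
lemma lobatto_r_formula:
  assumes "0 \<le> s"
  shows "lobatto_r (- s) = (24 - 6 * s) / lobatto_denom s"
proof -
  have "lobatto_r (- s) = 1 + (- s) * (lobatto_p (- s) \<bullet> 1)"
    unfolding lobatto_r_def lobatto_p_def by (simp add: dot_lmul_matrix)
  also have "lobatto_p (- s) \<bullet> 1 = (24 + 6 * s + s^2) / lobatto_denom s"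
    by (simp add: lobatto_p_formula[OF assms] inner_vec_def sum_3 add_divide_distrib[symmetric])
  also have "1 + (- s) * \<dots> = (24 - 6 * s) / lobatto_denom s"
    using lobatto_denom_pos[OF assms]
    by (simp add: divide_simps) (simp add: lobatto_denom_def algebra_simps power2_eq_square power3_eq_cube)
  finally show ?thesis .
qed

lemma abs_lobatto_r_le:
  assumes "0 \<le> s"
  shows "\<bar>lobatto_r (- s)\<bar> \<le> 1 / (1 + s)"
proof -
  have "0 \<le> s^2" "0 \<le> s^3"
    using assms by auto
  then have "\<bar>24 - 6 * s\<bar> * (1 + s) \<le> lobatto_denom s"
    using assms by (cases "s \<le> 4") (auto simp: lobatto_denom_def algebra_simps power2_eq_square)
  then show ?thesis
    using assms lobatto_denom_pos[OF assms]
    by (simp add: lobatto_r_formula abs_mult field_simps)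
qed

lemma abs_lobatto_r_le_1:
  assumes "0 \<le> s"
  shows "\<bar>lobatto_r (- s)\<bar> \<le> 1"
proof -
  have "1 / (1 + s) \<le> 1"
    using assms by simp
  with abs_lobatto_r_le[OF assms] show ?thesis
    by linarith
qed

text \<open>
  A fine step damps at least as much as a backward Euler step of the same size, and \<open>J\<close> backward Euler
  steps damp at least as much as one of \<open>J\<close> times the size.
\<close>
lemma abs_lobatto_r_power_le:
  assumes "0 \<le> s"
  shows "\<bar>lobatto_r (- s)\<bar> ^ J \<le> 1 / (1 + real J * s)"
proof -
  have "\<bar>lobatto_r (- s)\<bar> ^ J \<le> 1 / (1 + s) ^ J"
    using power_mono[OF abs_lobatto_r_le[OF assms], of J] by (simp add: power_divide)
  also have "\<dots> \<le> 1 / (1 + real J * s)"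
    using Bernoulli_inequality[of s J] assms by (intro divide_left_mono) (auto simp: add_pos_nonneg)
  finally show ?thesis .
qed

text \<open>
  This function is \<open>ln (r(-s))\<close>. The numerator of its second derivative is \<open>-s\<^sup>3\<close> times a positive factor: the
  lower-order terms vanish because \<open>r(-s)\<close> agrees with \<open>exp (-s)\<close>, whose logarithm is linear, up to
  terms of order \<open>s\<^sup>5\<close>.
\<close>
lemma concave_on_ln_lobatto_r: "concave_on {0..<4} (\<lambda>s. ln (24 - 6 * s) - ln (lobatto_denom s))"
proof (rule f''_le0_imp_concave)
  let ?d = lobatto_denom
  fix s :: real assume s: "s \<in> {0..<4}"
  then have d: "?d s > 0" and pos: "24 - 6 * s > 0"
    using lobatto_denom_pos by auto
  have D: "(?d has_real_derivative 18 + 12 * s + 3 * s^2) (at s)"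
    unfolding lobatto_denom_def by (auto intro!: derivative_eq_intros)
  show "((\<lambda>s. ln (24 - 6 * s) - ln (?d s)) has_real_derivative
      - 6 / (24 - 6 * s) - (18 + 12 * s + 3 * s^2) / ?d s) (at s)"
    using d pos by (auto intro!: derivative_eq_intros D simp: divide_simps)
  show "((\<lambda>s. - 6 / (24 - 6 * s) - (18 + 12 * s + 3 * s^2) / ?d s) has_real_derivative
      - 1 / (4 - s)^2 + (36 + 72 * s + 72 * s^2 + 24 * s^3 + 3 * s^4) / (?d s)^2) (at s)"
  proof -
    have a: "- 36 / (24 - 6 * s)^2 = - 1 / (4 - s)^2"
    proof -
      have "(24 - 6 * s)^2 = 36 * (4 - s)^2"
        by (simp add: power2_eq_square algebra_simps)
      then show ?thesis
        by simp
    qed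
    have "((\<lambda>s. - 6 / (24 - 6 * s) - (18 + 12 * s + 3 * s^2) / ?d s) has_real_derivative
       - 36 / (24 - 6 * s)^2 - ((12 + 6 * s) * ?d s - (18 + 12 * s + 3 * s^2)^2) / (?d s)^2) (at s)"
      using d pos by (auto intro!: derivative_eq_intros D simp: power2_eq_square)
    also have "(12 + 6 * s) * ?d s - (18 + 12 * s + 3 * s^2)^2 =
        - (36 + 72 * s + 72 * s^2 + 24 * s^3 + 3 * s^4)"
      by (simp add: lobatto_denom_def algebra_simps power2_eq_square power3_eq_cube power4_eq_xxxx)
    finally show ?thesis
      unfolding a by (simp only: minus_divide_left[symmetric] diff_minus_eq_add)
  qed
  have "(?d s)^2 - (4 - s)^2 * (36 + 72 * s + 72 * s^2 + 24 * s^3 + 3 * s^4)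
      = s^3 * (384 + 144 * s + 2 * s^2 * (6 - s))"
    by (simp add: lobatto_denom_def algebra_simps power2_eq_square power3_eq_cube power4_eq_xxxx)
  also have "\<dots> \<ge> 0"
    using s by (intro mult_nonneg_nonneg add_nonneg_nonneg) auto
  finally show "- 1 / (4 - s)^2 + (36 + 72 * s + 72 * s^2 + 24 * s^3 + 3 * s^4) / (?d s)^2 \<le> 0"
    using s d by (simp add: field_simps)
qed simp

text \<open>
  For fixed \<open>x\<close> the value \<open>r(-x/J)\<^sup>J\<close> is smallest at \<open>J = 2\<close>: the point \<open>x/J\<close> lies the fraction \<open>2/J\<close> of
  the way from \<open>0\<close> to \<open>x/2\<close>, and \<open>ln (r(-s))\<close> is concave with value \<open>0\<close> at \<open>0\<close>. The bound \<open>x < 8\<close> keeps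
  both arguments below \<open>4\<close>, the zero of \<open>r(-s)\<close>.
\<close>
lemma lobatto_r_square_le_power:
  assumes "2 \<le> J" "0 \<le> x" "x < 8"
  shows "lobatto_r (- (x / 2)) ^ 2 \<le> lobatto_r (- (x / real J)) ^ J"
proof -
  have J: "0 < real J" "2 / real J \<le> 1"
    using assms by auto
  have less: "x / real J < 4"
    using assms by (auto simp: divide_less_eq intro: less_le_trans[of x 8])
  have pos: "lobatto_r (- s) > 0" if "0 \<le> s" "s < 4" for s
    using that by (simp add: lobatto_r_formula lobatto_denom_pos)
  define g where "g s = ln (24 - 6 * s) - ln (lobatto_denom s)" for s
  have ln_r: "ln (lobatto_r (- s)) = g s" if "0 \<le> s" "s < 4" for s
    using that lobatto_denom_pos[of s] by (simp add: g_def lobatto_r_formula ln_div)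
  have "g 0 = 0"
    by (simp add: g_def lobatto_denom_def)
  moreover have "concave_on {0..<4} g"
    using concave_on_ln_lobatto_r by (simp add: g_def[abs_def])
  ultimately have "2 / real J * g (x / 2) \<le> g (x / real J)"
    using concave_onD[of "{0..<4}" g "2 / real J" 0 "x / 2"] assms J by simp
  then have "2 / real J * ln (lobatto_r (- (x / 2))) \<le> ln (lobatto_r (- (x / real J)))"
    using assms less by (simp add: ln_r)
  then have "2 * ln (lobatto_r (- (x / 2))) \<le> real J * ln (lobatto_r (- (x / real J)))"
    using J by (simp add: field_simps)
  then have "ln (lobatto_r (- (x / 2)) ^ 2) \<le> ln (lobatto_r (- (x / real J)) ^ J)"
    using pos[of "x / 2"] pos[of "x / real J"] assms less by (simp add: ln_realpow)
  then show ?thesis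
    using pos[of "x / 2"] pos[of "x / real J"] assms less by simp
qed

text \<open>
  The case \<open>J = 2\<close> of the lower bound, with \<open>x = 2 s\<close>. Multiplied out, the difference of the two sides is
  \<open>s\<close> times a polynomial whose only negative coefficient is that of \<open>s\<close>; its cubic part is already
  positive for \<open>s \<ge> 0\<close>.
\<close>
lemma lobatto_r_square_ge:
  assumes "0 \<le> s"
  shows "1 - 0.62 * s \<le> (1 + 2 * s) * lobatto_r (- s) ^ 2"
proof -
  have cubic: "0 \<le> 357.12 - 616.32 * s + 187.44 * s^2 + 91.68 * s^3"
  proof -
    \<comment> \<open>\<open>(s - 1)\<^sup>2 (s + 2)\<close> is the gap between \<open>s\<^sup>3\<close> and its tangent at \<open>1\<close>. What is left is a quadratic
      with minimum near \<open>0.91\<close>; a square centred slightly to the right of it leaves positive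
      coefficients.\<close>
    have "357.12 - 616.32 * s + 187.44 * s^2 + 91.68 * s^3
        = 91.68 * ((s - 1)^2 * (s + 2)) + 187.44 * (s - 0.92)^2 + 3.6096 * s + 15.110784"
      by (simp add: field_simps power2_eq_square power3_eq_cube)
    then show ?thesis
      using assms by simp
  qed
  have "(1 + 2 * s) * (24 - 6 * s)^2 - (1 - 0.62 * s) * (lobatto_denom s)^2
      = s * ((357.12 - 616.32 * s + 187.44 * s^2 + 91.68 * s^3)
          + 32.64 * s^4 + 6.44 * s^5 + 0.62 * s^6)"
    by (simp add: lobatto_denom_def algebra_simps power2_eq_square power3_eq_cube eval_nat_numeral)
  also have "\<dots> \<ge> 0"
    using assms
    by (intro mult_nonneg_nonneg add_nonneg_nonneg[OF add_nonneg_nonneg[OF add_nonneg_nonneg[OF cubic]]]) auto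
  finally show ?thesis
    using lobatto_denom_pos[OF assms] by (simp add: lobatto_r_formula[OF assms] field_simps)
qed

text \<open>
  As \<open>J\<close> grows with \<open>x = J s\<close> fixed, the quotient of the two sides without the factor \<open>0.31\<close> tends to
  \<open>(1 - (1 + x) exp (-x)) / x\<close>, whose maximum is about \<open>0.298\<close>; the constant \<open>0.31\<close> leaves little room.
\<close>
lemma parareal_contraction_factor:
  assumes "2 \<le> J" "0 < s"
  shows "\<bar>lobatto_r (- s) ^ J - 1 / (1 + real J * s)\<bar> \<le> 0.31 * (1 - 1 / (1 + real J * s))"
proof -
  define x where "x = real J * s"
  have x: "0 < x"
    using assms by (simp add: x_def)
  have s: "s = x / real J"
    using assms by (simp add: x_def)
  have abs: "\<bar>lobatto_r (- s) ^ J\<bar> \<le> 1 / (1 + x)"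
    using abs_lobatto_r_power_le[of s J] assms by (simp add: x_def power_abs)
  have lower: "1 - 0.31 * x \<le> (1 + x) * lobatto_r (- s) ^ J"
  proof (cases "x < 8")
    case True
    have "1 - 0.31 * x \<le> (1 + x) * lobatto_r (- (x / 2)) ^ 2"
      using lobatto_r_square_ge[of "x / 2"] x by simp
    also have "\<dots> \<le> (1 + x) * lobatto_r (- s) ^ J"
      using lobatto_r_square_le_power[OF assms(1) _ True] x unfolding s by (intro mult_left_mono) auto
    finally show ?thesis .
  next
    case False
    \<comment> \<open>\<open>r(-s)\<close> may be negative here, but \<open>0.31 x\<close> already exceeds \<open>2\<close>.\<close>
    moreover have "- 1 \<le> (1 + x) * lobatto_r (- s) ^ J"
      using abs x by (auto simp: field_simps abs_le_iff)
    ultimately show ?thesis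
      by simp
  qed
  have upper: "(1 + x) * lobatto_r (- s) ^ J \<le> 1"
    using abs x by (auto simp: field_simps abs_le_iff)
  have "\<bar>lobatto_r (- s) ^ J - 1 / (1 + x)\<bar> = \<bar>(1 + x) * lobatto_r (- s) ^ J - 1\<bar> / (1 + x)"
  proof -
    have "lobatto_r (- s) ^ J - 1 / (1 + x) = ((1 + x) * lobatto_r (- s) ^ J - 1) / (1 + x)"
      using x by (simp add: diff_divide_distrib)
    then show ?thesis
      using x by (simp add: abs_divide)
  qed
  also have "\<dots> \<le> 0.31 * x / (1 + x)"
    using lower upper x by (intro divide_right_mono) auto
  also have "\<dots> = 0.31 * (1 - 1 / (1 + x))"
    using x by (simp add: field_simps)
  finally show ?thesis
    by (simp add: x_def)
qed

section \<open>Orthogonality in Hilbert spaces\<close>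

lemma orthogonal_sum_norm_square:
  fixes f :: "'i \<Rightarrow> 'a::real_inner"
  assumes "finite F" "\<And>i j. i \<in> F \<Longrightarrow> j \<in> F \<Longrightarrow> i \<noteq> j \<Longrightarrow> f i \<bullet> f j = 0"
  shows "(norm (sum f F))\<^sup>2 = (\<Sum>i\<in>F. (norm (f i))\<^sup>2)"
proof -
  have "(norm (sum f F))\<^sup>2 = (\<Sum>i\<in>F. \<Sum>j\<in>F. f i \<bullet> f j)"
    by (simp add: power2_norm_eq_inner inner_sum_left inner_sum_right) (rule sum.swap)
  also have "\<dots> = (\<Sum>i\<in>F. \<Sum>j\<in>F. if j = i then f i \<bullet> f i else 0)"
    using assms(2) by (intro sum.cong refl) auto
  also have "\<dots> = (\<Sum>i\<in>F. (norm (f i))\<^sup>2)"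
    using assms(1) by (simp add: power2_norm_eq_inner)
  finally show ?thesis .
qed

text \<open>
  By the Pythagorean theorem two partial sums containing a common finite set \<open>F0\<close> differ by at most
  twice the root of the tail of the squared norms outside \<open>F0\<close>, so the net of partial sums is Cauchy.
\<close>
lemma orthogonal_square_summable_summable:
  fixes f :: "'i \<Rightarrow> 'a::{real_inner, complete_space}"
  assumes orth: "\<And>i j. i \<in> A \<Longrightarrow> j \<in> A \<Longrightarrow> i \<noteq> j \<Longrightarrow> f i \<bullet> f j = 0"
    and sq: "(\<lambda>i. (norm (f i))\<^sup>2) summable_on A"
  shows "f summable_on A"
proof -
  let ?q = "\<lambda>i. (norm (f i))\<^sup>2"
  have "\<exists>P. eventually P (finite_subsets_at_top A) \<and>
              (\<forall>F F'. P F \<and> P F' \<longrightarrow> dist (sum f F) (sum f F') < e)" if "e > 0" for e :: real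
  proof -
    define d where "d = (e / 3)\<^sup>2"
    have "d > 0"
      using that by (simp add: d_def)
    then obtain F0 where F0: "finite F0" "F0 \<subseteq> A" "dist (sum ?q F0) (infsum ?q A) \<le> d"
      using infsum_finite_approximation[OF sq] by blast
    have near: "dist (sum f F) (sum f F0) \<le> e / 3" if F: "finite F" "F0 \<subseteq> F" "F \<subseteq> A" for F
    proof -
      have "(dist (sum f F) (sum f F0))\<^sup>2 = (norm (sum f (F - F0)))\<^sup>2"
        using F by (simp add: dist_norm sum_diff)
      also have "\<dots> = sum ?q (F - F0)"
        using F by (intro orthogonal_sum_norm_square orth) auto
      also have "\<dots> = sum ?q F - sum ?q F0"
        using F by (simp add: sum_diff)
      also have "\<dots> \<le> infsum ?q A - sum ?q F0"
        using finite_sum_le_infsum[OF sq F(1,3)] by simp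
      also have "\<dots> \<le> (e / 3)\<^sup>2"
        using F0(3) by (simp add: dist_real_def d_def abs_le_iff)
      finally show ?thesis
        using \<open>e > 0\<close> by (simp add: power2_le_iff_abs_le)
    qed
    have "dist (sum f F) (sum f F') < e"
      if "finite F \<and> F0 \<subseteq> F \<and> F \<subseteq> A" "finite F' \<and> F0 \<subseteq> F' \<and> F' \<subseteq> A" for F F'
      using near[of F] near[of F'] that \<open>e > 0\<close> dist_triangle2[of "sum f F" "sum f F'" "sum f F0"] by auto
    moreover have "eventually (\<lambda>F. finite F \<and> F0 \<subseteq> F \<and> F \<subseteq> A) (finite_subsets_at_top A)"
      unfolding eventually_finite_subsets_at_top using F0 by blast
    ultimately show ?thesis
      by (intro exI[of _ "\<lambda>F. finite F \<and> F0 \<subseteq> F \<and> F \<subseteq> A"]) simp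
  qed
  then have "cauchy_filter (filtermap (sum f) (finite_subsets_at_top A))"
    by (simp add: cauchy_filter_metric_filtermap)
  then obtain L where "(sum f \<longlongrightarrow> L) (finite_subsets_at_top A)"
    using complete_uniform[where S = "UNIV :: 'a set"] complete_UNIV by (force simp add: filterlim_def)
  then show ?thesis
    using summable_on_def has_sum_def by blast
qed

text \<open>
  The foot of the perpendicular is the point of \<open>V\<close> nearest to \<open>x\<close>. A minimising sequence is Cauchy by
  the parallelogram law, and moving from its limit along \<open>z\<close> cannot decrease the distance, which forces
  orthogonality to \<open>z\<close>.
\<close>
lemma orthogonal_decomposition_closed_subspace:
  fixes V :: "'a::{real_inner, complete_space} set"
  assumes "subspace V" "closed V"
  shows "\<exists>y\<in>V. \<forall>z\<in>V. (x - y) \<bullet> z = 0"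
proof -
  define d where "d = (INF y\<in>V. (norm (x - y))\<^sup>2)"
  have bdd: "bdd_below ((\<lambda>y. (norm (x - y))\<^sup>2) ` V)"
    by (rule bdd_belowI[of _ 0]) auto
  have ne: "V \<noteq> {}"
    using subspace_0[OF assms(1)] by auto
  have d_le: "d \<le> (norm (x - y))\<^sup>2" if "y \<in> V" for y
    unfolding d_def using bdd that by (rule cINF_lower)
  have "\<exists>y\<in>V. (norm (x - y))\<^sup>2 < d + 1 / real (Suc n)" for n
    using cINF_less_iff[OF ne bdd, of "d + 1 / real (Suc n)"] by (simp add: d_def)
  then obtain y where yV: "\<And>n. y n \<in> V" and y: "\<And>n. (norm (x - y n))\<^sup>2 < d + 1 / real (Suc n)"
    by metis
  have par: "(norm (u - v))\<^sup>2 \<le> 2 * (norm (x - u))\<^sup>2 + 2 * (norm (x - v))\<^sup>2 - 4 * d" if "u \<in> V" "v \<in> V" for u v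
  proof -
    have "(1/2) *\<^sub>R (u + v) \<in> V"
      using assms(1) that by (simp add: subspace_add subspace_scale)
    from d_le[OF this] have "4 * d \<le> (norm (2 *\<^sub>R (x - (1/2) *\<^sub>R (u + v))))\<^sup>2"
      unfolding norm_scaleR by (simp add: power_mult_distrib)
    also have "2 *\<^sub>R (x - (1/2) *\<^sub>R (u + v)) = (x - u) + (x - v)"
      by (simp add: algebra_simps scaleR_2)
    finally have "4 * d \<le> (norm ((x - u) + (x - v)))\<^sup>2" .
    moreover have "u - v = (x - v) - (x - u)"
      by simp
    ultimately show ?thesis
      by (simp add: power2_norm_eq_inner inner_add_left inner_add_right inner_diff_left inner_diff_right inner_commute)
  qed
  have "Cauchy y"
  proof (rule metric_CauchyI)
    fix e :: real assume "e > 0"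
    then obtain N :: nat where N: "4 / e\<^sup>2 < real N"
      using reals_Archimedean2 by blast
    have "dist (y m) (y n) < e" if "N \<le> m" "N \<le> n" for m n
    proof -
      have "1 / real (Suc k) < e\<^sup>2 / 4" if "N \<le> k" for k
      proof -
        have "4 / e\<^sup>2 < real (Suc k)"
          using N that by (meson le_imp_less_Suc less_trans of_nat_less_iff)
        then show ?thesis
          using \<open>e > 0\<close> by (simp add: field_simps)
      qed
      from this[OF that(1)] this[OF that(2)]
      have "(norm (y m - y n))\<^sup>2 < e\<^sup>2"
        using par[OF yV yV, of m n] y[of m] y[of n] by linarith
      then show ?thesis
        using \<open>e > 0\<close> by (simp add: dist_norm power2_less_imp_less)
    qed
    then show "\<exists>M. \<forall>m\<ge>M. \<forall>n\<ge>M. dist (y m) (y n) < e"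
      by blast
  qed
  then obtain p where p: "y \<longlonglongrightarrow> p"
    using Cauchy_convergent convergent_def by blast
  have pV: "p \<in> V"
    using closed_sequentially[OF assms(2) _ p] yV by blast
  have "(\<lambda>n. (norm (x - y n))\<^sup>2) \<longlonglongrightarrow> (norm (x - p))\<^sup>2"
    by (intro tendsto_intros p)
  moreover have "(\<lambda>n. d + 1 / real (Suc n)) \<longlonglongrightarrow> d + 0"
    by (intro tendsto_intros LIMSEQ_Suc[OF lim_1_over_n])
  ultimately have min: "(norm (x - p))\<^sup>2 \<le> d"
    using y LIMSEQ_le[of "\<lambda>n. (norm (x - y n))\<^sup>2" _ "\<lambda>n. d + 1 / real (Suc n)"] by (simp add: less_imp_le)
  have "(x - p) \<bullet> z = 0" if "z \<in> V" for z
  proof (cases "z = 0")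
    case False
    \<comment> \<open>The step that brings \<open>p + t z\<close> closest to \<open>x\<close>.\<close>
    define t where "t = ((x - p) \<bullet> z) / (z \<bullet> z)"
    have "p + t *\<^sub>R z \<in> V"
      using assms(1) pV that by (simp add: subspace_add subspace_scale)
    from d_le[OF this] min have "(norm (x - p))\<^sup>2 \<le> (norm ((x - p) - t *\<^sub>R z))\<^sup>2"
      unfolding diff_diff_add by linarith
    then have "2 * t * ((x - p) \<bullet> z) \<le> t * t * (z \<bullet> z)"
      by (simp add: power2_norm_eq_inner inner_diff_left inner_diff_right inner_commute algebra_simps)
    moreover have "t * (z \<bullet> z) = (x - p) \<bullet> z"
      using False by (simp add: t_def)
    ultimately have "t * ((x - p) \<bullet> z) \<le> 0"
      by (metis mult.assoc mult_2 add_le_same_cancel1 distrib_right)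
    then have "((x - p) \<bullet> z)\<^sup>2 / (z \<bullet> z) \<le> 0"
      by (simp add: t_def power2_eq_square)
    then show ?thesis
      using False by (auto simp: divide_le_0_iff not_le simp flip: inner_gt_zero_iff)
  qed simp
  then show ?thesis
    using pV by blast
qed

lemma orthogonal_projection_eqI:
  assumes "subspace V" "y \<in> V" "\<And>z. z \<in> V \<Longrightarrow> (x - y) \<bullet> z = 0"
  shows "orthogonal_projection V x = y"
  unfolding orthogonal_projection_def
proof (rule the_equality)
  fix y' assume y': "y' \<in> V \<and> (\<forall>z\<in>V. (x - y') \<bullet> z = 0)"
  then have "y - y' \<in> V"
    using assms by (simp add: subspace_diff)
  then have "(x - y') \<bullet> (y - y') - (x - y) \<bullet> (y - y') = 0"
    using assms(3) y' by simp
  then show "y' = y"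
    by (simp add: inner_diff_left[symmetric])
qed (use assms in auto)

context
  fixes V :: "'a::{real_inner, complete_space} set"
  assumes V: "subspace V" "closed V"
begin

lemma orthogonal_projection_mem: "orthogonal_projection V x \<in> V"
  and orthogonal_projection_orthogonal: "z \<in> V \<Longrightarrow> (x - orthogonal_projection V x) \<bullet> z = 0"
proof -
  obtain y where y: "y \<in> V" "\<forall>z\<in>V. (x - y) \<bullet> z = 0"
    using orthogonal_decomposition_closed_subspace[OF V] by blast
  then have "orthogonal_projection V x = y"
    by (intro orthogonal_projection_eqI V) auto
  with y show "orthogonal_projection V x \<in> V" "z \<in> V \<Longrightarrow> (x - orthogonal_projection V x) \<bullet> z = 0"
    by auto
qed

lemma inner_orthogonal_projection:
  "orthogonal_projection V x \<bullet> x = (norm (orthogonal_projection V x))\<^sup>2"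
  using orthogonal_projection_orthogonal[OF orthogonal_projection_mem, of x x]
  by (simp add: power2_norm_eq_inner inner_diff_left inner_commute[of "orthogonal_projection V x" x])

lemma norm_orthogonal_projection_le: "norm (orthogonal_projection V x) \<le> norm x"
proof -
  have "(norm (orthogonal_projection V x))\<^sup>2 \<le> norm (orthogonal_projection V x) * norm x"
    unfolding inner_orthogonal_projection[symmetric] by (rule norm_cauchy_schwarz)
  then show ?thesis
    by (cases "norm (orthogonal_projection V x) = 0") (auto simp: power2_eq_square mult_le_cancel_left)
qed

lemma bounded_linear_orthogonal_projection: "bounded_linear (orthogonal_projection V)"
proof (rule bounded_linear_intro[where K = 1])
  fix x y r
  note P = orthogonal_projection_mem orthogonal_projection_orthogonal
  show "orthogonal_projection V (x + y) = orthogonal_projection V x + orthogonal_projection V y"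
    using P(2)[of _ x] P(2)[of _ y]
    by (intro orthogonal_projection_eqI V subspace_add P(1))
      (simp add: add_diff_add inner_add_left)
  show "orthogonal_projection V (r *\<^sub>R x) = r *\<^sub>R orthogonal_projection V x"
    using P(2)[of _ x]
    by (intro orthogonal_projection_eqI V subspace_scale P(1)) (simp flip: scaleR_diff_right)
qed (simp add: norm_orthogonal_projection_le)

end

section \<open>Spectral decomposition of a positive operator with compact inverse\<close>

locale positive_selfadjoint_operator =
  fixes D :: "'a::{real_inner, complete_space} set" and A :: "'a \<Rightarrow> 'a"
  assumes linear_operator: "linear_operator D A"
    and selfadjoint: "selfadjoint D A"
    and positive_definite: "positive_definite D A"
    and has_compact_inverse: "has_compact_inverse D A"
begin

definition K :: "'a \<Rightarrow> 'a" where "K = the_inv_into D A"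

abbreviation E :: "real \<Rightarrow> 'a set" where "E \<equiv> eigenspace D A"

abbreviation P :: "real \<Rightarrow> 'a \<Rightarrow> 'a" where "P l \<equiv> orthogonal_projection (E l)"

abbreviation \<Lambda> :: "real set" where "\<Lambda> \<equiv> eigenvalues D A"

lemma K_in_D: "K x \<in> D" and A_K: "A (K x) = x" and K_A: "y \<in> D \<Longrightarrow> K (A y) = y"
proof -
  have bij: "bij_betw A D UNIV"
    using has_compact_inverse by (simp add: has_compact_inverse_def)
  show "K x \<in> D"
    unfolding K_def using bij by (intro the_inv_into_into) (auto simp: bij_betw_def)
  show "A (K x) = x"
    unfolding K_def using bij by (intro f_the_inv_into_f_bij_betw) auto
  show "K (A y) = y" if "y \<in> D"
    unfolding K_def using bij that by (intro the_inv_into_f_f) (auto simp: bij_betw_def)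
qed

lemma linear_K: "linear K" and compact_K: "bounded S \<Longrightarrow> compact (closure (K ` S))"
  using has_compact_inverse by (auto simp: has_compact_inverse_def compact_operator_def K_def)

lemma bounded_linear_K: "bounded_linear K"
proof -
  have "bounded (closure (K ` cball 0 1))"
    using compact_K[of "cball 0 1"] compact_imp_bounded by auto
  then have "bounded (K ` cball 0 1)"
    using closure_subset by (rule bounded_subset)
  then obtain B where B: "\<forall>y\<in>K ` cball 0 1. norm y \<le> B"
    unfolding bounded_iff by blast
  have "norm (K x) \<le> norm x * B" for x
  proof (cases "x = 0")
    case False
    then have "norm (K (x /\<^sub>R norm x)) \<le> B"
      by (intro B[rule_format] imageI) simp
    then show ?thesis
      using False by (simp add: linear_scale[OF linear_K] field_simps)
  qed (simp add: linear_0[OF linear_K])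
  then show ?thesis
    using linear_K by (auto intro!: bounded_linear_intro simp: linear_add linear_scale)
qed

lemma K_symmetric: "K x \<bullet> y = x \<bullet> K y"
proof -
  have "(K y, A (K y)) \<in> adjoint_graph D A"
    using selfadjoint K_in_D by (auto simp: selfadjoint_def)
  then have "A (K x) \<bullet> K y = K x \<bullet> A (K y)"
    using K_in_D by (simp add: adjoint_graph_def)
  then show ?thesis
    by (simp add: A_K)
qed

lemma K_positive: "x \<noteq> 0 \<Longrightarrow> K x \<bullet> x > 0"
proof -
  assume x: "x \<noteq> 0"
  have "K x \<noteq> 0"
    using x A_K linear_0[OF linear_K] by metis
  then have "A (K x) \<bullet> K x > 0"
    using positive_definite K_in_D by (simp add: positive_definite_def)
  then show ?thesis
    by (simp add: A_K inner_commute)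
qed

lemma K_nonneg: "K x \<bullet> x \<ge> 0"
  using K_positive[of x] by (cases "x = 0") auto

text \<open>
  The Rayleigh quotient of \<open>K\<close> has a positive supremum \<open>M\<close> on the unit sphere of \<open>W\<close>. For a maximising sequence
  \<open>x n\<close> the residuals \<open>K (x n) - M x n\<close> tend to zero, and compactness of \<open>K\<close> provides a subsequence along
  which \<open>K (x n)\<close>, hence also \<open>x n\<close>, converges; the limit is an eigenvector.
\<close>
lemma exists_eigenvector_in_invariant_subspace:
  assumes W: "subspace W" "closed W" "\<And>x. x \<in> W \<Longrightarrow> K x \<in> W"
    and x0: "x0 \<in> W" "x0 \<noteq> 0"
  obtains x M where "x \<in> W" "x \<noteq> 0" "M > 0" "K x = M *\<^sub>R x"
proof -
  interpret K: bounded_linear K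
    by (rule bounded_linear_K)
  define S where "S = {x \<in> W. norm x = 1}"
  define M where "M = (SUP x\<in>S. K x \<bullet> x)"
  obtain B where B: "\<And>x. norm (K x) \<le> norm x * B"
    using K.bounded by blast
  have "K x \<bullet> x \<le> B" if "x \<in> S" for x
    using B[of x] norm_cauchy_schwarz[of "K x" x] that by (simp add: S_def)
  then have bdd: "bdd_above ((\<lambda>x. K x \<bullet> x) ` S)"
    by (auto simp: bdd_above_def)
  have normalised: "x /\<^sub>R norm x \<in> S" if "x \<in> W" "x \<noteq> 0" for x
    using that W(1) by (simp add: S_def subspace_scale)
  then have ne: "S \<noteq> {}"
    using x0 by blast
  have le_M: "K x \<bullet> x \<le> M" if "x \<in> S" for x
    unfolding M_def using bdd that by (intro cSUP_upper)
  have "M > 0"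
  proof -
    let ?u = "x0 /\<^sub>R norm x0"
    have "0 < K ?u \<bullet> ?u"
      using x0 by (intro K_positive) simp
    with le_M[OF normalised[OF x0]] show ?thesis
      by linarith
  qed
  have quadratic_le: "K x \<bullet> x \<le> M * (x \<bullet> x)" if "x \<in> W" for x
  proof (cases "x = 0")
    case False
    then show ?thesis
      using le_M[OF normalised[OF that False]]
      by (simp add: K.scaleR divide_simps power2_eq_square flip: power2_norm_eq_inner)
  qed simp
  have residual: "(norm (K x - M *\<^sub>R x))\<^sup>2 \<le> M * (M - K x \<bullet> x)" if "x \<in> S" for x
  proof -
    let ?b = "K x \<bullet> K x"
    have x: "x \<in> W" "x \<bullet> x = 1"
      using that by (auto simp: S_def norm_eq_1)
    \<comment> \<open>Positivity of the quadratic form at \<open>x - K x / M\<close> gives \<open>\<parallel>K x\<parallel>\<^sup>2 \<le> M (K x \<bullet> x)\<close>.\<close>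
    have "0 \<le> K (x - (1 / M) *\<^sub>R K x) \<bullet> (x - (1 / M) *\<^sub>R K x)"
      by (rule K_nonneg)
    also have "\<dots> = K x \<bullet> x - 2 / M * ?b + (1 / M)\<^sup>2 * (K (K x) \<bullet> K x)"
      by (simp add: K.diff K.scaleR K_symmetric[of "K x" x] inner_diff_left inner_diff_right power2_eq_square
          diff_divide_distrib)
    also have "\<dots> \<le> K x \<bullet> x - 2 / M * ?b + (1 / M)\<^sup>2 * (M * ?b)"
      using quadratic_le[OF W(3)[OF x(1)]] by (intro add_left_mono mult_left_mono) auto
    also have "\<dots> = K x \<bullet> x - ?b / M"
      using \<open>M > 0\<close> by (simp add: power2_eq_square field_simps)
    finally have "?b \<le> M * (K x \<bullet> x)"
      using \<open>M > 0\<close> by (simp add: field_simps)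
    moreover have "(norm (K x - M *\<^sub>R x))\<^sup>2 = ?b - 2 * M * (K x \<bullet> x) + M * M"
      by (simp add: power2_norm_eq_inner inner_diff_left inner_diff_right inner_commute x)
    ultimately show ?thesis
      by (simp add: algebra_simps)
  qed
  have "\<exists>x\<in>S. M - 1 / real (Suc n) < K x \<bullet> x" for n
    using less_cSUP_iff[OF ne bdd, of "M - 1 / real (Suc n)"] by (simp add: M_def)
  then obtain x where xS: "\<And>n. x n \<in> S" and x: "\<And>n. M - 1 / real (Suc n) < K (x n) \<bullet> x n"
    by metis
  have "(\<lambda>n. (norm (K (x n) - M *\<^sub>R x n))\<^sup>2) \<longlonglongrightarrow> 0"
  proof (rule tendsto_sandwich[where f = "\<lambda>_. 0" and h = "\<lambda>n. M * (1 / real (Suc n))"])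
    show "\<forall>\<^sub>F n in sequentially. (norm (K (x n) - M *\<^sub>R x n))\<^sup>2 \<le> M * (1 / real (Suc n))"
    proof (rule always_eventually, rule allI)
      fix n
      have "M * (M - K (x n) \<bullet> x n) \<le> M * (1 / real (Suc n))"
        using x[of n] \<open>M > 0\<close> by (intro mult_left_mono) auto
      then show "(norm (K (x n) - M *\<^sub>R x n))\<^sup>2 \<le> M * (1 / real (Suc n))"
        using residual[OF xS[of n]] by linarith
    qed
    show "(\<lambda>n. M * (1 / real (Suc n))) \<longlonglongrightarrow> 0"
      using tendsto_mult_left[OF LIMSEQ_Suc[OF lim_1_over_n], of M] by simp
  qed auto
  then have "(\<lambda>n. sqrt ((norm (K (x n) - M *\<^sub>R x n))\<^sup>2)) \<longlonglongrightarrow> sqrt 0"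
    by (rule tendsto_real_sqrt)
  then have res0: "(\<lambda>n. K (x n) - M *\<^sub>R x n) \<longlonglongrightarrow> 0"
    by (simp add: tendsto_norm_zero_iff)
  have "K (x n) \<in> closure (K ` cball 0 1)" for n
    using xS[of n] closure_subset by (force simp: S_def)
  then obtain l r where r: "strict_mono (r :: nat \<Rightarrow> nat)" and l: "((\<lambda>n. K (x n)) \<circ> r) \<longlonglongrightarrow> l"
    using compact_K[of "cball 0 1"] unfolding compact_def by (metis bounded_cball)
  define p where "p = (1 / M) *\<^sub>R l"
  have "(\<lambda>n. (1 / M) *\<^sub>R (K (x (r n)) - (K (x (r n)) - M *\<^sub>R x (r n)))) \<longlonglongrightarrow> (1 / M) *\<^sub>R (l - 0)"
    using l LIMSEQ_subseq_LIMSEQ[OF res0 r] by (intro tendsto_intros) (auto simp: o_def)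
  then have xp: "(\<lambda>n. x (r n)) \<longlonglongrightarrow> p"
    using \<open>M > 0\<close> by (simp add: p_def)
  have "p \<in> W"
    using closed_sequentially[OF W(2) _ xp] xS by (auto simp: S_def)
  moreover have "norm p = 1"
    using tendsto_norm[OF xp] xS by (simp add: S_def LIMSEQ_const_iff)
  moreover have "K p = l"
    using LIMSEQ_unique[OF K.tendsto[OF xp]] l by (simp add: o_def)
  then have "K p = M *\<^sub>R p"
    using \<open>M > 0\<close> by (simp add: p_def)
  ultimately show ?thesis
    using that[of p M] \<open>M > 0\<close> by fastforce
qed

text \<open>
  In terms of the bounded operator \<open>K\<close> the eigenspaces are visibly closed, and no domain condition remains.
\<close>
lemma eigenspace_iff: "x \<in> E l \<longleftrightarrow> l *\<^sub>R K x = x"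
proof
  assume "x \<in> E l"
  then have "x \<in> D" "A x = l *\<^sub>R x"
    by (auto simp: eigenspace_def)
  then show "l *\<^sub>R K x = x"
    using K_A[of x] by (simp add: linear_scale[OF linear_K])
next
  assume x: "l *\<^sub>R K x = x"
  have "l *\<^sub>R K x \<in> D" "A (l *\<^sub>R K x) = l *\<^sub>R A (K x)"
    using linear_operator K_in_D by (auto simp: linear_operator_def subspace_scale)
  then show "x \<in> E l"
    unfolding x by (simp add: eigenspace_def A_K)
qed

lemma subspace_eigenspace: "subspace (E l)"
  by (auto simp: subspace_def eigenspace_iff linear_0[OF linear_K] linear_add[OF linear_K]
      linear_scale[OF linear_K] scaleR_add_right)
    (metis mult.commute scaleR_scaleR)

lemma closed_eigenspace: "closed (E l)"
proof -
  have "E l = {x. l *\<^sub>R K x = x}"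
    using eigenspace_iff by blast
  then show ?thesis
    by (simp add: closed_Collect_eq continuous_intros linear_continuous_on[OF bounded_linear_K])
qed

lemmas P_mem = orthogonal_projection_mem[OF subspace_eigenspace closed_eigenspace]
  and P_orthogonal = orthogonal_projection_orthogonal[OF subspace_eigenspace closed_eigenspace]
  and P_inner = inner_orthogonal_projection[OF subspace_eigenspace closed_eigenspace]
  and P_eqI = orthogonal_projection_eqI[OF subspace_eigenspace]
  and bounded_linear_P = bounded_linear_orthogonal_projection[OF subspace_eigenspace closed_eigenspace]

lemma eigenvalue_pos:
  assumes "l \<in> \<Lambda>"
  shows "l > 0"
proof -
  obtain x where x: "x \<in> E l" "x \<noteq> 0"
    using assms subspace_0[OF subspace_eigenspace, of l] by (auto simp: eigenvalues_def)
  then have "l * (K x \<bullet> x) = x \<bullet> x"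
    by (metis eigenspace_iff inner_scaleR_left)
  then show ?thesis
    using x K_positive[of x] by (metis inner_gt_zero_iff zero_less_mult_pos2)
qed

lemma eigenspaces_orthogonal:
  assumes "x \<in> E l" "y \<in> E m" "l \<noteq> m"
  shows "x \<bullet> y = 0"
proof -
  have x: "l *\<^sub>R K x = x" and y: "m *\<^sub>R K y = y"
    using assms by (auto simp: eigenspace_iff)
  have "m * (x \<bullet> y) = m * ((l *\<^sub>R K x) \<bullet> y)"
    by (simp add: x)
  also have "\<dots> = l * (x \<bullet> (m *\<^sub>R K y))"
    by (simp add: K_symmetric)
  also have "\<dots> = l * (x \<bullet> y)"
    by (simp add: y)
  finally show ?thesis
    using assms(3) by simp
qed

lemma P_P: "P m (P l v) = (if l = m then P l v else 0)"
proof (cases "l = m")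
  case True
  then show ?thesis
    using P_mem by (auto intro!: P_eqI)
next
  case False
  then show ?thesis
    using eigenspaces_orthogonal[OF P_mem[of l v]] subspace_0[OF subspace_eigenspace]
    by (auto intro!: P_eqI)
qed

lemma bessel_inequality:
  assumes "finite F"
  shows "(\<Sum>l\<in>F. (norm (P l v))\<^sup>2) \<le> (norm v)\<^sup>2"
proof -
  let ?w = "\<Sum>l\<in>F. P l v"
  have w: "(norm ?w)\<^sup>2 = (\<Sum>l\<in>F. (norm (P l v))\<^sup>2)"
    using assms eigenspaces_orthogonal[OF P_mem P_mem] by (intro orthogonal_sum_norm_square) auto
  have "?w \<bullet> v = (\<Sum>l\<in>F. (norm (P l v))\<^sup>2)"
    by (simp add: inner_sum_left P_inner)
  moreover have "0 \<le> (norm (v - ?w))\<^sup>2"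
    by simp
  then have "0 \<le> (norm v)\<^sup>2 - 2 * (?w \<bullet> v) + (norm ?w)\<^sup>2"
    by (simp add: power2_norm_eq_inner inner_diff_left inner_diff_right inner_commute)
  ultimately show ?thesis
    using w by linarith
qed

lemma spectral_sum_summable:
  assumes "\<And>l. l \<in> \<Lambda> \<Longrightarrow> \<bar>g l\<bar> \<le> B"
  shows "(\<lambda>l. g l *\<^sub>R P l v) summable_on \<Lambda>"
proof (rule orthogonal_square_summable_summable)
  show "(g l *\<^sub>R P l v) \<bullet> (g m *\<^sub>R P m v) = 0" if "l \<noteq> m" for l m
    using eigenspaces_orthogonal[OF P_mem P_mem that] by simp
  show "(\<lambda>l. (norm (g l *\<^sub>R P l v))\<^sup>2) summable_on \<Lambda>"
  proof (rule nonneg_bdd_above_summable_on)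
    have "(\<Sum>l\<in>F. (norm (g l *\<^sub>R P l v))\<^sup>2) \<le> B\<^sup>2 * (norm v)\<^sup>2" if F: "F \<subseteq> \<Lambda>" "finite F" for F
    proof -
      have "(norm (g l *\<^sub>R P l v))\<^sup>2 \<le> B\<^sup>2 * (norm (P l v))\<^sup>2" if "l \<in> \<Lambda>" for l
        using power_mono[OF assms[OF that] abs_ge_zero, of 2]
        by (simp add: power_mult_distrib mult_right_mono)
      then have "(\<Sum>l\<in>F. (norm (g l *\<^sub>R P l v))\<^sup>2) \<le> B\<^sup>2 * (\<Sum>l\<in>F. (norm (P l v))\<^sup>2)"
        using F by (auto simp: sum_distrib_left intro!: sum_mono)
      also have "\<dots> \<le> B\<^sup>2 * (norm v)\<^sup>2"
        by (intro mult_left_mono bessel_inequality F) auto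
      finally show ?thesis .
    qed
    then show "bdd_above (sum (\<lambda>l. (norm (g l *\<^sub>R P l v))\<^sup>2) ` {F. F \<subseteq> \<Lambda> \<and> finite F})"
      by (auto intro!: bdd_aboveI)
  qed simp
qed

lemma spectral_fun_has_sum:
  assumes "\<And>l. l \<in> \<Lambda> \<Longrightarrow> \<bar>g l\<bar> \<le> B"
  shows "((\<lambda>l. g l *\<^sub>R P l v) has_sum spectral_fun D A g v) \<Lambda>"
  unfolding spectral_fun_def using spectral_sum_summable[OF assms] by (rule has_sum_infsum)

lemma P_spectral_fun:
  assumes "\<And>l. l \<in> \<Lambda> \<Longrightarrow> \<bar>g l\<bar> \<le> B" "m \<in> \<Lambda>"
  shows "P m (spectral_fun D A g v) = g m *\<^sub>R P m v"
proof -
  interpret P: bounded_linear "P m"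
    by (rule bounded_linear_P)
  have "((\<lambda>l. P m (g l *\<^sub>R P l v)) has_sum P m (spectral_fun D A g v)) \<Lambda>"
    using spectral_fun_has_sum[OF assms(1)] by (rule has_sum_bounded_linear[OF bounded_linear_P])
  moreover have "((\<lambda>l. P m (g l *\<^sub>R P l v)) has_sum g m *\<^sub>R P m v) \<Lambda>"
    using assms(2) by (intro has_sum_finite_neutralI[where B = "{m}"]) (auto simp: P.scaleR P_P)
  ultimately show ?thesis
    by (rule has_sum_unique)
qed

text \<open>
  The remainder \<open>v - (\<Sum>l. P l v)\<close> is orthogonal to all eigenspaces. The vectors with this property form a closed
  subspace which is invariant under \<open>K\<close>; if it were nonzero it would contain an eigenvector,
  orthogonal to itself.
\<close>
lemma spectral_expansion: "((\<lambda>l. P l v) has_sum v) \<Lambda>"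
proof -
  let ?w = "spectral_fun D A (\<lambda>_. 1) v"
  define W where "W = {x. \<forall>l\<in>\<Lambda>. \<forall>z\<in>E l. x \<bullet> z = 0}"
  have "v - ?w = 0"
  proof (rule ccontr)
    assume nz: "v - ?w \<noteq> 0"
    have "(v - ?w) \<bullet> z = 0" if l: "l \<in> \<Lambda>" and z: "z \<in> E l" for l z
    proof -
      have "P l ?w = P l v"
        using P_spectral_fun[of "\<lambda>_. 1" 1 l v] l by simp
      then show ?thesis
        using P_orthogonal[OF z, of v] P_orthogonal[OF z, of ?w] by (simp add: inner_diff_left)
    qed
    then have mem: "v - ?w \<in> W"
      by (simp add: W_def)
    have W: "subspace W"
      by (auto simp: W_def subspace_def inner_add_left)
    have "W = (\<Inter>l\<in>\<Lambda>. \<Inter>z\<in>E l. {x. x \<bullet> z = 0})"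
      by (auto simp: W_def)
    then have closed: "closed W"
      by (auto intro!: closed_INT closed_Collect_eq continuous_intros)
    have invariant: "K x \<in> W" if "x \<in> W" for x
    proof -
      have "K x \<bullet> z = 0" if "l \<in> \<Lambda>" "z \<in> E l" for l z
      proof -
        have "l * (K x \<bullet> z) = x \<bullet> (l *\<^sub>R K z)"
          by (simp add: K_symmetric)
        also have "\<dots> = 0"
          using that \<open>x \<in> W\<close> by (auto simp: eigenspace_iff W_def)
        finally show ?thesis
          using eigenvalue_pos[OF that(1)] by simp
      qed
      then show ?thesis
        by (simp add: W_def)
    qed
    obtain y M where y: "y \<in> W" "y \<noteq> 0" "M > 0" "K y = M *\<^sub>R y"
      using exists_eigenvector_in_invariant_subspace[OF W closed invariant mem nz] by blast
    then have "y \<in> E (1 / M)"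
      by (simp add: eigenspace_iff)
    moreover from this have "1 / M \<in> \<Lambda>"
      using y(2) by (auto simp: eigenvalues_def)
    ultimately have "y \<bullet> y = 0"
      using y(1) by (auto simp: W_def)
    then show False
      using y(2) by simp
  qed
  then show ?thesis
    using spectral_fun_has_sum[of "\<lambda>_. 1" 1 v] by simp
qed

text \<open>
  Only finite parts of the spectrum need to be considered, as the norm is a limit over them.
\<close>
lemma norm_le_if_spectral_parts_le:
  assumes "\<And>F. finite F \<Longrightarrow> F \<subseteq> \<Lambda> \<Longrightarrow> L2_set (\<lambda>l. norm (P l v)) F \<le> c"
  shows "norm v \<le> c"
proof (rule tendsto_upperbound)
  show "((\<lambda>F. norm (\<Sum>l\<in>F. P l v)) \<longlongrightarrow> norm v) (finite_subsets_at_top \<Lambda>)"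
    using spectral_expansion by (intro tendsto_norm) (simp add: has_sum_def)
  have "norm (\<Sum>l\<in>F. P l v) \<le> c" if F: "finite F" "F \<subseteq> \<Lambda>" for F
  proof -
    have "(norm (\<Sum>l\<in>F. P l v))\<^sup>2 = (\<Sum>l\<in>F. (norm (P l v))\<^sup>2)"
      using F eigenspaces_orthogonal[OF P_mem P_mem] by (intro orthogonal_sum_norm_square) auto
    then have "norm (\<Sum>l\<in>F. P l v) = L2_set (\<lambda>l. norm (P l v)) F"
      by (simp add: L2_set_def real_sqrt_unique)
    with assms F show ?thesis
      by simp
  qed
  then show "\<forall>\<^sub>F F in finite_subsets_at_top \<Lambda>. norm (\<Sum>l\<in>F. P l v) \<le> c"
    by (intro eventually_finite_subsets_at_top_weakI)
qed simp

lemma L2_set_spectral_parts_le: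
  assumes "finite F"
  shows "L2_set (\<lambda>l. norm (P l v)) F \<le> norm v"
  unfolding L2_set_def using bessel_inequality[OF assms] by (intro real_le_lsqrt) (auto simp: sum_nonneg)

lemma backward_euler_denominator_gt_1: "l \<in> \<Lambda> \<Longrightarrow> 0 < \<tau> \<Longrightarrow> 1 < 1 + \<tau> * l"
  using eigenvalue_pos by simp

text \<open>
  A sum of eigenvectors need not lie in \<open>D\<close>, so the sum \<open>w\<close> on the right-hand side is exhibited as \<open>K u\<close>, where
  \<open>u\<close> is the sum with coefficients \<open>l / (1 + \<tau> l)\<close>; these are bounded, so that \<open>u\<close> exists. Then
  \<open>A w = u\<close> and \<open>w + \<tau> A w\<close> is the expansion of the right-hand side \<open>h\<close> of the equation to be
  solved. Positivity makes the solution unique.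
\<close>
lemma coarse_prop_eq_spectral_fun:
  assumes "\<tau> > 0"
  shows "coarse_prop D A t \<tau> v f = spectral_fun D A (\<lambda>l. 1 / (1 + \<tau> * l)) (v + \<tau> *\<^sub>R f t)"
proof -
  define h where "h = v + \<tau> *\<^sub>R f t"
  define w where "w = spectral_fun D A (\<lambda>l. 1 / (1 + \<tau> * l)) h"
  define u where "u = spectral_fun D A (\<lambda>l. l / (1 + \<tau> * l)) h"
  have bound_w: "\<bar>1 / (1 + \<tau> * l)\<bar> \<le> 1" and bound_u: "\<bar>l / (1 + \<tau> * l)\<bar> \<le> 1 / \<tau>" if "l \<in> \<Lambda>" for l
  proof -
    note pos = eigenvalue_pos[OF that]
    show "\<bar>1 / (1 + \<tau> * l)\<bar> \<le> 1"
      using backward_euler_denominator_gt_1[OF that assms] by simp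
    have "l / (1 + \<tau> * l) \<le> l / (\<tau> * l)"
      using pos assms by (intro divide_left_mono) (auto simp: add_pos_pos)
    then show "\<bar>l / (1 + \<tau> * l)\<bar> \<le> 1 / \<tau>"
      using pos assms by (simp add: abs_of_nonneg)
  qed
  have w: "((\<lambda>l. (1 / (1 + \<tau> * l)) *\<^sub>R P l h) has_sum w) \<Lambda>"
    unfolding w_def using bound_w by (rule spectral_fun_has_sum)
  have u: "((\<lambda>l. (l / (1 + \<tau> * l)) *\<^sub>R P l h) has_sum u) \<Lambda>"
    unfolding u_def using bound_u by (rule spectral_fun_has_sum)
  have "((\<lambda>l. K ((l / (1 + \<tau> * l)) *\<^sub>R P l h)) has_sum K u) \<Lambda>"
    using u by (rule has_sum_bounded_linear[OF bounded_linear_K])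
  also have "?this \<longleftrightarrow> ((\<lambda>l. (1 / (1 + \<tau> * l)) *\<^sub>R P l h) has_sum K u) \<Lambda>"
  proof (rule has_sum_cong)
    fix l assume "l \<in> \<Lambda>"
    have "K ((l / (1 + \<tau> * l)) *\<^sub>R P l h) = (1 / (1 + \<tau> * l)) *\<^sub>R (l *\<^sub>R K (P l h))"
      by (simp add: linear_scale[OF linear_K])
    also have "l *\<^sub>R K (P l h) = P l h"
      using P_mem eigenspace_iff by blast
    finally show "K ((l / (1 + \<tau> * l)) *\<^sub>R P l h) = (1 / (1 + \<tau> * l)) *\<^sub>R P l h" .
  qed
  finally have "w = K u"
    using w has_sum_unique by blast
  then have wD: "w \<in> D" and Aw: "A w = u"
    by (simp_all add: K_in_D A_K)
  have "((\<lambda>l. (1 / (1 + \<tau> * l)) *\<^sub>R P l h + \<tau> *\<^sub>R ((l / (1 + \<tau> * l)) *\<^sub>R P l h)) has_sum w + \<tau> *\<^sub>R u) \<Lambda>"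
    using has_sum_bounded_linear[OF bounded_linear_scaleR_right u] by (intro has_sum_add w) simp
  also have "?this \<longleftrightarrow> ((\<lambda>l. P l h) has_sum w + \<tau> *\<^sub>R u) \<Lambda>"
  proof (rule has_sum_cong)
    fix l assume "l \<in> \<Lambda>"
    then have "1 + \<tau> * l \<noteq> 0"
      using backward_euler_denominator_gt_1[of l \<tau>] assms by simp
    then have "1 / (1 + \<tau> * l) + \<tau> * (l / (1 + \<tau> * l)) = 1"
      by (simp add: add_divide_distrib[symmetric])
    then show "(1 / (1 + \<tau> * l)) *\<^sub>R P l h + \<tau> *\<^sub>R ((l / (1 + \<tau> * l)) *\<^sub>R P l h) = P l h"
      by (metis scaleR_add_left scaleR_one scaleR_scaleR)
  qed
  finally have solves: "w + \<tau> *\<^sub>R A w = h"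
    using spectral_expansion[of h] has_sum_unique unfolding Aw by blast
  have inj: "inj_on (\<lambda>w. w + \<tau> *\<^sub>R A w) D"
  proof (rule inj_onI)
    fix x y assume xy: "x \<in> D" "y \<in> D" and eq: "x + \<tau> *\<^sub>R A x = y + \<tau> *\<^sub>R A y"
    have lin: "x - y \<in> D" "A (x - y) = A x - A y"
    proof -
      show "x - y \<in> D"
        using linear_operator xy by (simp add: linear_operator_def subspace_diff)
      have "A ((x - y) + y) = A (x - y) + A y"
        using linear_operator xy \<open>x - y \<in> D\<close> by (metis linear_operator_def)
      then show "A (x - y) = A x - A y"
        by simp
    qed
    have "(x - y) + \<tau> *\<^sub>R A (x - y) = 0"
      unfolding lin(2) using eq by (simp add: algebra_simps)
    then have "((x - y) + \<tau> *\<^sub>R A (x - y)) \<bullet> (x - y) = 0"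
      by simp
    then have zero: "(x - y) \<bullet> (x - y) + \<tau> * (A (x - y) \<bullet> (x - y)) = 0"
      by (simp only: inner_add_left inner_scaleR_left)
    show "x = y"
    proof (rule ccontr)
      assume "x \<noteq> y"
      then have "A (x - y) \<bullet> (x - y) > 0" "(x - y) \<bullet> (x - y) > 0"
        using positive_definite lin(1) by (auto simp: positive_definite_def)
      then show False
        using zero assms by (smt (verit) mult_pos_pos)
    qed
  qed
  show ?thesis
    unfolding coarse_prop_def h_def[symmetric] w_def[symmetric]
    using the_inv_into_f_f[OF inj wD] solves by simp
qed

end

section \<open>Error propagation of the parareal iteration\<close>

lemma fine_steps_add:
  "fine_steps D A f dt t v (i + j) = fine_steps D A f dt (t + real i * dt) (fine_steps D A f dt t v i) j"
  by (induction j) (simp_all add: algebra_simps)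

text \<open>
  In a row \<open>k + 1\<close> the bound \<open>\<gamma>\<^sup>k\<^sup>+\<^sup>1 m\<close> reproduces itself from one node to the next: the coarse step
  leaves the fraction \<open>\<rho>\<close> of it, and the contribution of row \<open>k\<close> is at most the missing fraction \<open>1 - \<rho>\<close>.
  Hence there is no growth with the number \<open>N\<close> of nodes.
\<close>
lemma parareal_error_decay:
  fixes e :: "nat \<Rightarrow> nat \<Rightarrow> 'v::real_normed_vector"
  assumes "0 \<le> \<rho>" "0 \<le> \<gamma>" and \<phi>: "\<bar>\<phi> - \<rho>\<bar> \<le> \<gamma> * (1 - \<rho>)"
    and init: "\<And>k. e (Suc k) 0 = 0"
    and step: "\<And>k n. e (Suc k) (Suc n) = \<rho> *\<^sub>R e (Suc k) n + (\<phi> - \<rho>) *\<^sub>R e k n"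
    and m: "\<And>n. n \<le> N \<Longrightarrow> norm (e 0 n) \<le> m"
  shows "n \<le> N \<Longrightarrow> norm (e k n) \<le> \<gamma> ^ k * m"
proof (induction k arbitrary: n)
  case (Suc k)
  note previous = Suc.IH
  have "0 \<le> m"
    using m[of 0] norm_ge_zero[of "e 0 0"] by linarith
  show ?case
    using Suc.prems
  proof (induction n)
    case 0
    show ?case
      using \<open>0 \<le> m\<close> assms(2) by (simp add: init)
  next
    case (Suc n)
    have "norm (e (Suc k) (Suc n)) \<le> \<rho> * norm (e (Suc k) n) + \<bar>\<phi> - \<rho>\<bar> * norm (e k n)"
      unfolding step using norm_triangle_ineq[of "\<rho> *\<^sub>R e (Suc k) n" "(\<phi> - \<rho>) *\<^sub>R e k n"] assms(1)
      by simp
    also have "\<dots> \<le> \<rho> * (\<gamma> ^ Suc k * m) + \<gamma> * (1 - \<rho>) * (\<gamma> ^ k * m)"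
      using Suc.IH Suc.prems previous[of n] assms(1) \<phi> abs_ge_zero[of "\<phi> - \<rho>"]
      by (intro add_mono mult_mono) auto
    also have "\<dots> = \<gamma> ^ Suc k * m"
      by (simp add: algebra_simps)
    finally show ?case .
  qed
qed (simp add: m)

lemma L2_set_sum_le:
  "L2_set (\<lambda>i. \<Sum>j\<in>S. g j i) F \<le> (\<Sum>j\<in>S. L2_set (g j) F)"
proof (induction S rule: infinite_finite_induct)
  case (insert j S)
  then show ?case
    using L2_set_triangle_ineq[of "g j" "\<lambda>i. \<Sum>j\<in>S. g j i" F] by simp
qed (simp_all add: L2_set_def)

context positive_selfadjoint_operator
begin

text \<open>
  A bound on the \<open>\<ell>\<^sup>2\<close> norm over the spectrum. Finite partial sums avoid summability conditions, and the
  rules below are those of a norm.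
\<close>
definition l2_bounded :: "(real \<Rightarrow> real) \<Rightarrow> real \<Rightarrow> bool" where
  "l2_bounded m C \<longleftrightarrow> (\<forall>F. finite F \<longrightarrow> F \<subseteq> \<Lambda> \<longrightarrow> L2_set m F \<le> C)"

lemma l2_bounded_spectral_parts: "norm v \<le> C \<Longrightarrow> l2_bounded (\<lambda>l. norm (P l v)) C"
  unfolding l2_bounded_def using L2_set_spectral_parts_le order_trans by blast

lemma l2_bounded_add:
  "l2_bounded m C \<Longrightarrow> l2_bounded m' C' \<Longrightarrow> l2_bounded (\<lambda>l. m l + m' l) (C + C')"
  unfolding l2_bounded_def by (intro allI impI order_trans[OF L2_set_triangle_ineq add_mono]) auto

lemma l2_bounded_cmult: "0 \<le> c \<Longrightarrow> l2_bounded m C \<Longrightarrow> l2_bounded (\<lambda>l. c * m l) (c * C)"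
  unfolding l2_bounded_def by (simp add: L2_set_right_distrib[symmetric] mult_left_mono)

lemma l2_bounded_sum:
  "(\<And>j. j \<in> S \<Longrightarrow> l2_bounded (m j) (C j)) \<Longrightarrow> l2_bounded (\<lambda>l. \<Sum>j\<in>S. m j l) (\<Sum>j\<in>S. C j)"
  unfolding l2_bounded_def
proof (intro allI impI)
  fix F assume bounds: "\<And>j. j \<in> S \<Longrightarrow> \<forall>F. finite F \<longrightarrow> F \<subseteq> \<Lambda> \<longrightarrow> L2_set (m j) F \<le> C j"
    and F: "finite F" "F \<subseteq> \<Lambda>"
  have "L2_set (\<lambda>l. \<Sum>j\<in>S. m j l) F \<le> (\<Sum>j\<in>S. L2_set (m j) F)"
    by (rule L2_set_sum_le)
  also have "\<dots> \<le> (\<Sum>j\<in>S. C j)"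
    using bounds F by (intro sum_mono) blast
  finally show "L2_set (\<lambda>l. \<Sum>j\<in>S. m j l) F \<le> (\<Sum>j\<in>S. C j)" .
qed

lemma norm_le_of_l2_bounded:
  assumes "l2_bounded m C" "0 \<le> c" "\<And>l. l \<in> \<Lambda> \<Longrightarrow> norm (P l v) \<le> c * m l"
  shows "norm v \<le> c * C"
proof (rule norm_le_if_spectral_parts_le)
  fix F assume F: "finite F" "F \<subseteq> \<Lambda>"
  have "L2_set (\<lambda>l. norm (P l v)) F \<le> L2_set (\<lambda>l. c * m l) F"
    using F assms(3) by (intro L2_set_mono) auto
  also have "\<dots> \<le> c * C"
    using l2_bounded_cmult[OF assms(2,1)] F by (simp add: l2_bounded_def)
  finally show "L2_set (\<lambda>l. norm (P l v)) F \<le> c * C" .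
qed

lemma P_fine_prop:
  assumes "l \<in> \<Lambda>" "0 \<le> dt"
  shows "P l (fine_prop D A t dt v f) = lobatto_r (- (dt * l)) *\<^sub>R P l v
    + dt *\<^sub>R (\<Sum>i\<in>UNIV. (lobatto_p (- (dt * l)) $ i) *\<^sub>R P l (f (t + lobatto_c $ i * dt)))"
proof -
  interpret P: bounded_linear "P l"
    by (rule bounded_linear_P)
  have nonneg: "0 \<le> dt * l" if "l \<in> \<Lambda>" for l
    using eigenvalue_pos[OF that] assms(2) by simp
  have "\<bar>lobatto_r (- dt * l)\<bar> \<le> 1" if "l \<in> \<Lambda>" for l
    using abs_lobatto_r_le_1[OF nonneg[OF that]] by simp
  then have r: "P l (spectral_fun D A (\<lambda>l. lobatto_r (- dt * l)) w) = lobatto_r (- dt * l) *\<^sub>R P l w" for w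
    by (rule P_spectral_fun[OF _ assms(1)])
  have "\<bar>lobatto_p (- dt * l) $ i\<bar> \<le> 1" if "l \<in> \<Lambda>" for l i
    using lobatto_p_bound[OF nonneg[OF that]] by simp
  then have p: "P l (spectral_fun D A (\<lambda>l. lobatto_p (- dt * l) $ i) w) = (lobatto_p (- dt * l) $ i) *\<^sub>R P l w" for i w
    by (rule P_spectral_fun[OF _ assms(1)])
  show ?thesis
    unfolding fine_prop_def by (simp add: P.add P.scaleR P.sum r[simplified] p[simplified])
qed

lemma P_coarse_prop:
  assumes "l \<in> \<Lambda>" "0 < \<tau>"
  shows "P l (coarse_prop D A t \<tau> v f) = (1 / (1 + \<tau> * l)) *\<^sub>R (P l v + \<tau> *\<^sub>R P l (f t))"
proof -
  interpret P: bounded_linear "P l"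
    by (rule bounded_linear_P)
  have "\<bar>1 / (1 + \<tau> * l)\<bar> \<le> 1" if "l \<in> \<Lambda>" for l
    using backward_euler_denominator_gt_1[OF that assms(2)] by simp
  then show ?thesis
    unfolding coarse_prop_eq_spectral_fun[OF assms(2)]
    using P_spectral_fun[OF _ assms(1), where B = 1] by (simp add: P.add P.scaleR)
qed

lemma P_fine_steps_diff:
  assumes "l \<in> \<Lambda>" "0 \<le> dt"
  shows "P l (fine_steps D A f dt t v j) - P l (fine_steps D A f dt t w j)
    = lobatto_r (- (dt * l)) ^ j *\<^sub>R (P l v - P l w)"
proof (induction j)
  case (Suc j)
  show ?case
    by (simp add: P_fine_prop[OF assms] Suc scaleR_diff_right[symmetric] flip: scaleR_scaleR)
qed simp

text \<open>
  The bound is increasing in the number of steps, so its value at the last step serves all of them. The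
  same holds for the next lemma.
\<close>
lemma norm_P_fine_steps_le:
  assumes "l \<in> \<Lambda>" "0 \<le> dt"
  shows "norm (P l (fine_steps D A f dt t v n))
    \<le> norm (P l v) + dt * (\<Sum>j<n. \<Sum>i\<in>UNIV. norm (P l (f (t + real j * dt + lobatto_c $ i * dt))))"
proof (induction n)
  case (Suc n)
  have pos: "0 \<le> dt * l"
    using assms(2) eigenvalue_pos[OF assms(1)] by simp
  let ?u = "fine_steps D A f dt t v n" and ?g = "\<lambda>i. P l (f (t + real n * dt + lobatto_c $ i * dt))"
  have "norm (lobatto_r (- (dt * l)) *\<^sub>R P l ?u) \<le> norm (P l ?u)"
    using abs_lobatto_r_le_1[OF pos] by (simp add: mult_left_le_one_le)
  moreover have "norm (\<Sum>i\<in>UNIV. (lobatto_p (- (dt * l)) $ i) *\<^sub>R ?g i) \<le> (\<Sum>i\<in>UNIV. norm (?g i))"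
    using lobatto_p_bound[OF pos] by (intro sum_norm_le) (simp add: mult_left_le_one_le)
  then have "norm (dt *\<^sub>R (\<Sum>i\<in>UNIV. (lobatto_p (- (dt * l)) $ i) *\<^sub>R ?g i)) \<le> dt * (\<Sum>i\<in>UNIV. norm (?g i))"
    using assms(2) by (simp add: mult_left_mono)
  ultimately have "norm (P l (fine_prop D A (t + real n * dt) dt ?u f))
      \<le> norm (P l ?u) + dt * (\<Sum>i\<in>UNIV. norm (?g i))"
    unfolding P_fine_prop[OF assms] by (intro norm_triangle_le) linarith
  with Suc show ?case
    by (simp add: distrib_left)
qed simp

lemma norm_P_initial_parareal_le:
  assumes "l \<in> \<Lambda>" "0 < dt" "0 < J"
  defines "\<tau> \<equiv> real J * dt"
  shows "norm (P l (parareal D A f u0 dt J 0 n)) \<le> norm (P l u0) + \<tau> * (\<Sum>j<n. norm (P l (f (real j * \<tau>))))"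
proof (induction n)
  case (Suc n)
  have \<tau>: "0 < \<tau>"
    using assms by (simp add: \<tau>_def)
  let ?h = "P l (parareal D A f u0 dt J 0 n) + \<tau> *\<^sub>R P l (f (real n * \<tau>))"
  have "norm (P l (parareal D A f u0 dt J 0 (Suc n))) = 1 / (1 + \<tau> * l) * norm ?h"
    using P_coarse_prop[OF assms(1) \<tau>] eigenvalue_pos[OF assms(1)] \<tau> by (simp add: \<tau>_def[symmetric])
  also have "\<dots> \<le> norm ?h"
    using backward_euler_denominator_gt_1[OF assms(1) \<tau>] by (intro mult_left_le_one_le) auto
  also have "\<dots> \<le> norm (P l (parareal D A f u0 dt J 0 n)) + \<tau> * norm (P l (f (real n * \<tau>)))"
    using \<tau> by (intro norm_triangle_le) simp
  finally show ?case
    using Suc by (simp add: distrib_left)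
qed simp

text \<open>
  The samples of \<open>f\<close> drop out: those of the two coarse corrections coincide, and the fine steps in the
  parareal iteration use the same nodes as the single step scheme.
\<close>
lemma P_parareal_error_step:
  fixes f :: "real \<Rightarrow> 'a" and u0 :: 'a
  assumes "l \<in> \<Lambda>" "0 < dt" "0 < J"
  defines "e \<equiv> \<lambda>k n. P l (parareal D A f u0 dt J k n - single_step D A f u0 dt (n * J))"
    and "\<rho> \<equiv> 1 / (1 + real J * (dt * l))"
  shows "e (Suc k) (Suc n) = \<rho> *\<^sub>R e (Suc k) n + (lobatto_r (- (dt * l)) ^ J - \<rho>) *\<^sub>R e k n"
proof -
  interpret P: bounded_linear "P l"
    by (rule bounded_linear_P)
  have regroup: "\<rho> *\<^sub>R (x + c) - \<rho> *\<^sub>R (y + c) + q *\<^sub>R (y - z) = \<rho> *\<^sub>R (x - z) + (q - \<rho>) *\<^sub>R (y - z)"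
    for x y z c :: 'a and q
    by (simp add: algebra_simps)
  let ?\<tau> = "real J * dt"
  have \<tau>: "0 < ?\<tau>"
    using assms by simp
  let ?Z = "single_step D A f u0 dt (n * J)"
  let ?X = "parareal D A f u0 dt J (Suc k) n" and ?Y = "parareal D A f u0 dt J k n"
  let ?fine = "\<lambda>v. P l (fine_steps D A f dt (real n * ?\<tau>) v J)"
  have single: "single_step D A f u0 dt (Suc n * J) = fine_steps D A f dt (real n * ?\<tau>) ?Z J"
    using fine_steps_add[of D A f dt 0 u0 "n * J" J] by (simp add: single_step_def add.commute mult.assoc)
  have "e (Suc k) (Suc n) = \<rho> *\<^sub>R (P l ?X + ?\<tau> *\<^sub>R P l (f (real n * ?\<tau>)))
      - \<rho> *\<^sub>R (P l ?Y + ?\<tau> *\<^sub>R P l (f (real n * ?\<tau>))) + (?fine ?Y - ?fine ?Z)"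
    unfolding e_def single parareal.simps Let_def P.diff P.add P_coarse_prop[OF assms(1) \<tau>]
    by (simp add: \<rho>_def mult.assoc)
  also have "?fine ?Y - ?fine ?Z = lobatto_r (- (dt * l)) ^ J *\<^sub>R (P l ?Y - P l ?Z)"
    using assms by (intro P_fine_steps_diff) auto
  finally show ?thesis
    unfolding e_def P.diff by (simp only: regroup)
qed

lemma norm_P_parareal_error_le:
  assumes l: "l \<in> \<Lambda>" and "0 < dt" "2 \<le> J" "n \<le> Nc"
  defines "\<tau> \<equiv> real J * dt"
  shows "norm (P l (parareal D A f u0 dt J k n - single_step D A f u0 dt (n * J)))
    \<le> 0.31 ^ k * (2 * norm (P l u0) + \<tau> * (\<Sum>j<Nc. norm (P l (f (real j * \<tau>))))
        + dt * (\<Sum>j<Nc * J. \<Sum>i\<in>UNIV. norm (P l (f (real j * dt + lobatto_c $ i * dt)))))"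
    (is "_ \<le> _ * ?m")
proof -
  interpret P: bounded_linear "P l"
    by (rule bounded_linear_P)
  have pos: "0 < dt * l"
    using assms(2) eigenvalue_pos[OF l] by simp
  have \<tau>: "0 \<le> \<tau>"
    using assms(2) by (simp add: \<tau>_def)
  show ?thesis
  proof (rule parareal_error_decay[where e = "\<lambda>k n. P l (parareal D A f u0 dt J k n - single_step D A f u0 dt (n * J))"
        and \<rho> = "1 / (1 + real J * (dt * l))" and \<phi> = "lobatto_r (- (dt * l)) ^ J" and N = Nc])
    show "\<bar>lobatto_r (- (dt * l)) ^ J - 1 / (1 + real J * (dt * l))\<bar> \<le> 0.31 * (1 - 1 / (1 + real J * (dt * l)))"
      using assms(3) pos by (rule parareal_contraction_factor)
    show "0 \<le> 1 / (1 + real J * (dt * l))"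
      using pos by simp
    fix n assume n: "n \<le> Nc"
    have mono: "(\<Sum>j<n. norm (P l (f (real j * \<tau>)))) \<le> (\<Sum>j<Nc. norm (P l (f (real j * \<tau>))))"
      "(\<Sum>j<n * J. \<Sum>i\<in>UNIV. norm (P l (f (real j * dt + lobatto_c $ i * dt))))
        \<le> (\<Sum>j<Nc * J. \<Sum>i\<in>UNIV. norm (P l (f (real j * dt + lobatto_c $ i * dt))))"
      using n by (intro sum_mono2; auto simp: sum_nonneg intro: less_le_trans)+
    have "norm (P l (parareal D A f u0 dt J 0 n))
        \<le> norm (P l u0) + \<tau> * (\<Sum>j<Nc. norm (P l (f (real j * \<tau>))))"
      using norm_P_initial_parareal_le[OF l assms(2), of J f u0 n, folded \<tau>_def]
        mult_left_mono[OF mono(1) \<tau>] assms(3) by linarith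
    moreover have "norm (P l (single_step D A f u0 dt (n * J)))
        \<le> norm (P l u0) + dt * (\<Sum>j<Nc * J. \<Sum>i\<in>UNIV. norm (P l (f (real j * dt + lobatto_c $ i * dt))))"
      using norm_P_fine_steps_le[OF l, of dt f 0 u0 "n * J"] mult_left_mono[OF mono(2), of dt] assms(2)
      unfolding single_step_def add_0_left by linarith
    ultimately show "norm (P l (parareal D A f u0 dt J 0 n - single_step D A f u0 dt (n * J))) \<le> ?m"
      unfolding P.diff using norm_triangle_ineq4 by (smt (verit))
  next
    fix k n
    show "P l (parareal D A f u0 dt J (Suc k) 0 - single_step D A f u0 dt (0 * J)) = 0"
      by (simp add: single_step_def P.zero)
    show "P l (parareal D A f u0 dt J (Suc k) (Suc n) - single_step D A f u0 dt (Suc n * J)) =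
      (1 / (1 + real J * (dt * l))) *\<^sub>R P l (parareal D A f u0 dt J (Suc k) n - single_step D A f u0 dt (n * J)) +
      (lobatto_r (- (dt * l)) ^ J - 1 / (1 + real J * (dt * l))) *\<^sub>R
        P l (parareal D A f u0 dt J k n - single_step D A f u0 dt (n * J))"
      using assms by (intro P_parareal_error_step) auto
  qed (use assms in auto)
qed

text \<open>
  The majorant of the previous lemma has \<open>Nc\<close> coarse samples with weight \<open>T / Nc\<close> and three times \<open>J Nc\<close> fine samples with
  weight \<open>T / (J Nc)\<close>, which accounts for the factor \<open>4 T\<close> independently of \<open>J\<close> and \<open>Nc\<close>.
\<close>
lemma norm_parareal_error_le:
  assumes "0 < T" "2 \<le> J" "1 \<le> Nc" "n \<le> Nc"
    and f: "\<And>t. t \<in> {0..T} \<Longrightarrow> norm (f t) \<le> B"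
  defines "dt \<equiv> T / real (J * Nc)"
  shows "norm (parareal D A f u0 dt J k n - single_step D A f u0 dt (n * J))
    \<le> 0.31 ^ k * (2 * norm u0 + 4 * T * B)"
proof -
  define \<tau> where "\<tau> = real J * dt"
  have dt: "0 < dt" and T: "T = real Nc * \<tau>" "T = real (Nc * J) * dt"
    using assms by (simp_all add: \<tau>_def dt_def)
  have \<tau>: "0 < \<tau>"
    using dt assms(2) by (simp add: \<tau>_def)
  have coarse: "norm (f (real j * \<tau>)) \<le> B" if "j < Nc" for j
    using that \<tau> by (intro f) (auto simp: T(1))
  have nodes: "0 \<le> lobatto_c $ i \<and> lobatto_c $ i \<le> 1" for i
    using exhaust_3[of i] by (auto simp: lobatto_c_def)
  have fine: "norm (f (real j * dt + lobatto_c $ i * dt)) \<le> B" if "j < Nc * J" for i j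
  proof (rule f)
    have "(real j + lobatto_c $ i) * dt \<le> real (Nc * J) * dt"
    proof (intro mult_right_mono)
      have "real (Suc j) \<le> real (Nc * J)"
        using that by (intro of_nat_mono) simp
      then show "real j + lobatto_c $ i \<le> real (Nc * J)"
        using nodes[of i] by simp
    qed (use dt in simp)
    then show "real j * dt + lobatto_c $ i * dt \<in> {0..T}"
      using nodes[of i] dt by (simp add: T(2) distrib_right)
  qed
  have "l2_bounded (\<lambda>l. 2 * norm (P l u0) + \<tau> * (\<Sum>j<Nc. norm (P l (f (real j * \<tau>))))
        + dt * (\<Sum>j<Nc * J. \<Sum>i\<in>UNIV. norm (P l (f (real j * dt + lobatto_c $ i * dt)))))
      (2 * norm u0 + \<tau> * (\<Sum>j<Nc. B) + dt * (\<Sum>j<Nc * J. \<Sum>i\<in>(UNIV :: 3 set). B))"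
    (is "l2_bounded ?m _")
    using dt \<tau> coarse fine
    by (intro l2_bounded_add l2_bounded_cmult l2_bounded_sum l2_bounded_spectral_parts) auto
  also have "2 * norm u0 + \<tau> * (\<Sum>j<Nc. B) + dt * (\<Sum>j<Nc * J. \<Sum>i\<in>(UNIV :: 3 set). B)
      = 2 * norm u0 + (real Nc * \<tau>) * B + 3 * (real (Nc * J) * dt) * B"
    by simp
  also have "\<dots> = 2 * norm u0 + 4 * T * B"
    unfolding T[symmetric] by simp
  finally have "l2_bounded ?m (2 * norm u0 + 4 * T * B)" .
  then show ?thesis
  proof (rule norm_le_of_l2_bounded)
    show "norm (P l (parareal D A f u0 dt J k n - single_step D A f u0 dt (n * J))) \<le> 0.31 ^ k * ?m l"
      if "l \<in> \<Lambda>" for l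
      unfolding \<tau>_def by (rule norm_P_parareal_error_le[OF that dt assms(2,4)])
  qed simp
qed

end

theorem proposition4p3:
  fixes D :: "'a::{real_inner, complete_space} set"
    and A :: "'a \<Rightarrow> 'a"
    and f :: "real \<Rightarrow> 'a"
    and u0 :: 'a
    and T :: real
  assumes "linear_operator D A"
    and "densely_defined D"
    and "selfadjoint D A"
    and "positive_definite D A"
    and "has_compact_inverse D A"
    and "T > 0"
    and "continuous_on {0..T} f"
  shows "\<exists>c. \<forall>J Nc k :: nat. J \<ge> 2 \<longrightarrow> Nc \<ge> 1 \<longrightarrow>
           (let dt = T / real (J * Nc) in
             (MAX n\<in>{1..Nc}. norm (parareal D A f u0 dt J k n - single_step D A f u0 dt (n * J)))
               \<le> c * 0.31 ^ k)"
proof -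
  interpret positive_selfadjoint_operator D A
    using assms by unfold_locales
  have "bounded (f ` {0..T})"
    using assms(7) by (intro compact_imp_bounded compact_continuous_image) auto
  then have "\<exists>B. \<forall>t\<in>{0..T}. norm (f t) \<le> B"
    by (simp add: bounded_iff)
  then obtain B where B: "\<forall>t\<in>{0..T}. norm (f t) \<le> B"
    by blast
  show ?thesis
  proof (intro exI allI impI)
    fix J Nc k :: nat assume J: "2 \<le> J" and Nc: "1 \<le> Nc"
    let ?dt = "T / real (J * Nc)"
    have "norm (parareal D A f u0 ?dt J k n - single_step D A f u0 ?dt (n * J))
        \<le> (2 * norm u0 + 4 * T * B) * 0.31 ^ k" if "n \<le> Nc" for n
      unfolding mult.commute[of _ "0.31 ^ k"] using norm_parareal_error_le[OF assms(6) J Nc that] B by blast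
    then show "let dt = T / real (J * Nc) in
        (MAX n\<in>{1..Nc}. norm (parareal D A f u0 dt J k n - single_step D A f u0 dt (n * J)))
          \<le> (2 * norm u0 + 4 * T * B) * 0.31 ^ k"
      unfolding Let_def using Nc by (subst Max_le_iff) auto
  qed
qed

end
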